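(* Let $k\ge 2$ be an integer and let $c_1,\dots,c_k$ be real numbers with $c_\ell>1$ for all $\ell$ and $\sum_{\ell=1}^{k} c_\ell^{-1}=1$. Then, as operators on the Hilbert space $(\mathbb{C}^2)^{\otimes (k+1)}$ of $k+1$ qubits labeled $1,\dots,k+1$, $$P_{\mathrm{sing}}^{(1,k+1)}\;\le\;\sum_{\ell=1}^{k} c_\ell\, P_{\mathrm{sing}}^{(\ell,\ell+1)} .$$
   Context: For distinct qubits $i\neq m$, $P_{\mathrm{sing}}^{(i,m)}$ denotes the orthogonal projector $|\mathrm{sing}\rangle_{i,m}\langle \mathrm{sing}|$ onto the singlet state $|\mathrm{sing}\rangle_{i,m}=\left(|\!\uparrow\rangle_i|\!\downarrow\rangle_m-|\!\downarrow\rangle_i|\!\uparrow\rangle_m\right)/\sqrt{2}$ of qubits $i$ and $m$, tensored with the identity on all other qubits; here $|\!\uparrow\rangle,|\!\downarrow\rangle$ is the standard orthonormal basis of $\mathbb{C}^2$. For Hermitian operators $A,B$, the inequality $A\le B$ means that $B-A$ is positive semidefinite. *)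

theory Defs
  imports "HOL-Analysis.Analysis"
begin

datatype spin = Up | Down

lemma UNIV_spin: "UNIV = {Up, Down}"
  using spin.exhaust by auto

instance spin :: finite
  by standard (simp add: UNIV_spin)

text \<open>
  For a finite type \<open>'q\<close> of qubits, the Hilbert space of all the qubits is
  \<open>complex ^ ('q \<Rightarrow> spin)\<close>: the coordinate at \<open>s :: 'q \<Rightarrow> spin\<close> is the amplitude of the
  product basis vector in which each qubit \<open>j\<close> is in state \<open>s j\<close>. Two qubits on their own
  have the Hilbert space \<open>complex ^ (spin \<times> spin)\<close>.
\<close>

type_synonym 'a operator = "complex ^ 'a ^ 'a"

definition ket :: "'a::finite \<Rightarrow> complex ^ 'a" where
  "ket a = axis a 1"

definition tensor :: "complex ^ 'a \<Rightarrow> complex ^ 'b \<Rightarrow> complex ^ ('a::finite \<times> 'b::finite)"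
    (infixr "\<otimes>" 72) where
  "u \<otimes> v = (\<chi> p. u $ fst p * v $ snd p)"

definition cinner :: "complex ^ 'a::finite \<Rightarrow> complex ^ 'a \<Rightarrow> complex" where
  "cinner u v = (\<Sum>a\<in>UNIV. cnj (u $ a) * v $ a)"

definition ketbra :: "complex ^ 'a::finite \<Rightarrow> complex ^ 'a \<Rightarrow> 'a operator" where
  "ketbra u v = (\<chi> a b. u $ a * cnj (v $ b))"

definition hermitian :: "'a::finite operator \<Rightarrow> bool" where
  "hermitian A \<longleftrightarrow> map_matrix cnj (transpose A) = A"

definition pos_semidef :: "'a::finite operator \<Rightarrow> bool" where
  "pos_semidef A \<longleftrightarrow> hermitian A \<and> (\<forall>v. 0 \<le> Re (cinner v (A *v v)))"

definition loewner_le :: "'a::finite operator \<Rightarrow> 'a operator \<Rightarrow> bool"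
    (infix "\<le>\<^sub>L" 50) where
  "A \<le>\<^sub>L B \<longleftrightarrow> hermitian A \<and> hermitian B \<and> pos_semidef (B - A)"

definition singlet :: "complex ^ (spin \<times> spin)" where
  "singlet = (1 / sqrt 2) *\<^sub>R (ket Up \<otimes> ket Down - ket Down \<otimes> ket Up)"

text \<open>
  The two-qubit operator \<open>Q\<close> acting on qubits \<open>i\<close> and \<open>m\<close> (in this order), tensored with the
  identity on all other qubits, in the product basis: a matrix entry of a tensor product of
  operators is the product of the entries of the factors, here with one factor \<open>mat 1\<close> for
  each qubit other than \<open>i\<close> and \<open>m\<close>. Meaningful for \<open>i \<noteq> m\<close> only.
\<close>

definition on_qubits :: "'q::finite \<Rightarrow> 'q \<Rightarrow> (spin \<times> spin) operator \<Rightarrow> ('q \<Rightarrow> spin) operator" where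
  "on_qubits i m Q =
     (\<chi> s t. Q $ (s i, s m) $ (t i, t m) * (\<Prod>j\<in>- {i, m}. (mat 1 :: spin operator) $ s j $ t j))"

definition P_sing :: "'q::finite \<Rightarrow> 'q \<Rightarrow> ('q \<Rightarrow> spin) operator" where
  "P_sing i m = on_qubits i m (ketbra singlet singlet)"

end

theory Submission
  imports Defs
begin

text \<open>
  The quadratic form of \<open>P_sing i m\<close> at \<open>v\<close> is a quarter of
  \<open>\<Sum>s. |v s - v s'|\<^sup>2\<close>, where \<open>s'\<close> is \<open>s\<close> with the spins at \<open>i\<close> and \<open>m\<close> exchanged.
  A spin has only two values, so for three qubits the singlet amplitudes add up along
  \<open>i, j, m\<close>, for instance
  \<open>v(\<up>\<down>\<down>) - v(\<down>\<down>\<up>) = (v(\<up>\<down>\<down>) - v(\<down>\<up>\<down>)) + (v(\<down>\<up>\<down>) - v(\<down>\<down>\<up>))\<close>,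
  and Cauchy-Schwarz gives \<open>P\<^sub>i\<^sub>m \<le> (1/a + 1/b) (a P\<^sub>i\<^sub>j + b P\<^sub>j\<^sub>m)\<close>. Induction along the
  chain of qubits yields \<open>P\<^sub>1\<^sub>,\<^sub>k\<^sub>+\<^sub>1 \<le> (\<Sum> 1/c\<^sub>l) (\<Sum> c\<^sub>l P\<^sub>l\<^sub>,\<^sub>l\<^sub>+\<^sub>1)\<close> for all positive \<open>c\<^sub>l\<close>.
\<close>

definition exch :: "'q \<Rightarrow> 'q \<Rightarrow> ('q \<Rightarrow> 'a) \<Rightarrow> 'q \<Rightarrow> 'a" where
  "exch i m s = s(i := s m, m := s i)"

lemma exch_exch [simp]: "exch i m (exch i m s) = s"
  by (auto simp: exch_def)

lemma sum_exch:
  fixes f :: "('q::finite \<Rightarrow> 'a::finite) \<Rightarrow> 'b::comm_monoid_add"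
  shows "(\<Sum>s\<in>UNIV. f (exch i m s)) = (\<Sum>s\<in>UNIV. f s)"
  by (rule sum.reindex_bij_witness[of _ "exch i m" "exch i m"]) auto

lemma singlet_nth:
  "singlet $ (x, y) = (if x = y then 0 else if x = Up then 1 / sqrt 2 else - 1 / sqrt 2)"
  by (cases x; cases y) (simp_all add: singlet_def tensor_def ket_def axis_def scaleR_conv_of_real[where 'a = complex])

lemma prod_mat_1:
  "(\<Prod>j\<in>A. (mat 1 :: 'a::finite operator) $ s j $ t j) = (if \<forall>j\<in>A. s j = t j then 1 else 0)"
  if "finite A"
  using that by induction (auto simp: mat_def)

lemma ketbra_singlet_nth:
  "ketbra singlet singlet $ (x, y) $ (z, w) =
     (of_bool (x = z \<and> y = w) - of_bool (y = z \<and> x = w)) / 2"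
proof -
  have "complex_of_real (sqrt 2) * complex_of_real (sqrt 2) = 2"
    by (simp flip: of_real_mult)
  then show ?thesis
    by (cases x; cases y; cases z; cases w) (simp_all add: ketbra_def singlet_nth)
qed

text \<open>This is the identity P = (1 - SWAP)/2, with \<open>exch i m\<close> as the action of
  SWAP on basis labels. Both sides vanish unless \<open>s\<close> and \<open>t\<close> agree away
  from \<open>i\<close> and \<open>m\<close>, which leaves a two-qubit computation.\<close>

lemma P_sing_nth:
  assumes "i \<noteq> m"
  shows "P_sing i m $ s $ t = (of_bool (s = t) - of_bool (exch i m s = t)) / 2"
proof (cases "\<forall>j\<in>- {i, m}. s j = t j")
  case True
  then have "s = t \<longleftrightarrow> s i = t i \<and> s m = t m"
    by fastforce
  moreover have "exch i m s = t \<longleftrightarrow> s m = t i \<and> s i = t m"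
    using True assms by (fastforce simp: exch_def)
  ultimately show ?thesis
    using True unfolding P_sing_def on_qubits_def
    by (simp add: prod_mat_1 ketbra_singlet_nth del: Compl_iff)
next
  case False
  then have "s \<noteq> t" "exch i m s \<noteq> t"
    by (auto simp: exch_def)
  with False show ?thesis
    unfolding P_sing_def on_qubits_def vec_lambda_beta prod_mat_1[OF finite] if_not_P[OF False]
    by simp
qed

lemma P_sing_mult_nth:
  assumes "i \<noteq> m"
  shows "(P_sing i m *v v) $ s = (v $ s - v $ exch i m s) / 2"
proof -
  have "(P_sing i m *v v) $ s =
      (\<Sum>t\<in>UNIV. (if s = t then v $ t / 2 else 0) - (if exch i m s = t then v $ t / 2 else 0))"
    unfolding matrix_vector_mult_def vec_lambda_beta
    by (rule sum.cong) (auto simp: P_sing_nth[OF assms])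
  then show ?thesis
    by (simp add: sum_subtractf diff_divide_distrib)
qed

definition quad :: "'a::finite operator \<Rightarrow> complex ^ 'a \<Rightarrow> real" where
  "quad A v = Re (cinner v (A *v v))"

lemma quad_add: "quad (A + B) v = quad A v + quad B v"
  by (simp add: quad_def cinner_def matrix_vector_mult_add_rdistrib ring_distribs sum.distrib)

lemma quad_diff: "quad (A - B) v = quad A v - quad B v"
  by (simp add: quad_def cinner_def matrix_vector_mult_diff_rdistrib ring_distribs sum_subtractf)

lemma quad_scaleR: "quad (r *\<^sub>R A) v = r * quad A v"
proof -
  have "(r *\<^sub>R A) *v v = r *\<^sub>R (A *v v)"
    by (simp add: vec_eq_iff matrix_vector_mult_def scaleR_sum_right)
  then have "cinner v ((r *\<^sub>R A) *v v) = r *\<^sub>R cinner v (A *v v)"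
    by (simp add: cinner_def scaleR_sum_right)
  then show ?thesis
    by (simp add: quad_def)
qed

lemma quad_sum: "quad (sum A I) v = (\<Sum>l\<in>I. quad (A l) v)"
proof -
  have "quad 0 v = 0"
    by (simp add: quad_def cinner_def)
  then show ?thesis
    by (induction I rule: infinite_finite_induct) (simp_all add: quad_add)
qed

lemma hermitian_iff: "hermitian A \<longleftrightarrow> (\<forall>a b. cnj (A $ b $ a) = A $ a $ b)"
  by (simp add: hermitian_def vec_eq_iff map_matrix_def transpose_def)

lemma hermitian_diff: "hermitian A \<Longrightarrow> hermitian B \<Longrightarrow> hermitian (A - B)"
  by (simp add: hermitian_iff)

lemma hermitian_scaleR: "hermitian A \<Longrightarrow> hermitian (r *\<^sub>R A)"
  by (simp add: hermitian_iff)

lemma hermitian_sum: "(\<And>l. l \<in> I \<Longrightarrow> hermitian (A l)) \<Longrightarrow> hermitian (sum A I)"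
  by (simp add: hermitian_iff)

lemma hermitian_P_sing:
  assumes "i \<noteq> m"
  shows "hermitian (P_sing i m)"
proof -
  have "exch i m s = t \<longleftrightarrow> exch i m t = s" for s t :: "'a \<Rightarrow> spin"
    by auto
  then show ?thesis
    unfolding hermitian_iff P_sing_nth[OF assms] by (auto simp: of_bool_def)
qed

text \<open>Exchanging is an involution on the basis labels, so the form can be symmetrized by
  pairing each \<open>s\<close> with \<open>exch i m s\<close>; the two cross terms then complete a
  square.\<close>

lemma quad_P_sing:
  assumes "i \<noteq> m"
  shows "quad (P_sing i m) v = (\<Sum>s\<in>UNIV. (cmod (v $ s - v $ exch i m s))\<^sup>2) / 4"
proof -
  let ?f = "\<lambda>s. Re (cnj (v $ s) * (v $ s - v $ exch i m s))"
  have "(cmod (v $ s - v $ exch i m s))\<^sup>2 = ?f s + ?f (exch i m s)" for s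
    unfolding cmod_power2 by (simp add: power2_eq_square algebra_simps)
  then have "(\<Sum>s\<in>UNIV. (cmod (v $ s - v $ exch i m s))\<^sup>2) = 2 * (\<Sum>s\<in>UNIV. ?f s)"
    by (simp only: sum.distrib sum_exch[of ?f] mult_2)
  moreover have "quad (P_sing i m) v = (\<Sum>s\<in>UNIV. ?f s) / 2"
    by (simp add: quad_def cinner_def P_sing_mult_nth[OF assms] sum_divide_distrib)
  ultimately show ?thesis
    by simp
qed

lemma sum_spin: "(\<Sum>x\<in>UNIV. f x) = f Up + f Down"
  by (simp add: UNIV_spin)

text \<open>Localizes a sum over all configurations at one qubit. Each configuration is reached
  twice, from itself and from its flip at \<open>i\<close>, hence the division by 2.\<close>

lemma sum_fun_upd:
  fixes F :: "('q::finite \<Rightarrow> spin) \<Rightarrow> real"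
  shows "(\<Sum>s\<in>UNIV. F s) = (\<Sum>s\<in>UNIV. \<Sum>x\<in>UNIV. F (s(i := x))) / 2"
proof -
  define flip :: "('q \<Rightarrow> spin) \<Rightarrow> 'q \<Rightarrow> spin"
    where "flip s = s(i := (case s i of Up \<Rightarrow> Down | Down \<Rightarrow> Up))" for s
  have flip_flip: "flip (flip s) = s" for s
    by (cases "s i") (auto simp: flip_def)
  have "(\<Sum>x\<in>UNIV. F (s(i := x))) = F s + F (flip s)" for s
  proof -
    have "s(i := s i) = s"
      by simp
    then show ?thesis
      by (cases "s i") (simp_all add: sum_spin flip_def)
  qed
  moreover have "(\<Sum>s\<in>UNIV. F (flip s)) = (\<Sum>s\<in>UNIV. F s)"
    by (rule sum.reindex_bij_witness[of _ flip flip]) (simp_all add: flip_flip)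
  ultimately show ?thesis
    by (simp add: sum.distrib)
qed

text \<open>Weighted Cauchy-Schwarz: after the triangle inequality, the defect is exactly the square
  \<open>(a * norm x - b * norm y)\<^sup>2 / (a * b)\<close>.\<close>

lemma norm_add_power2_le:
  fixes x y :: "'a::real_normed_vector"
  assumes "a > 0" "b > 0"
  shows "(norm (x + y))\<^sup>2 \<le> (1 / a + 1 / b) * (a * (norm x)\<^sup>2 + b * (norm y)\<^sup>2)"
proof -
  have "(norm (x + y))\<^sup>2 \<le> (norm x + norm y)\<^sup>2"
    by (simp add: norm_triangle_ineq power_mono)
  also have "\<dots> \<le> (norm x + norm y)\<^sup>2 + (a * norm x - b * norm y)\<^sup>2 / (a * b)"
    using assms by simp
  also have "\<dots> = (1 / a + 1 / b) * (a * (norm x)\<^sup>2 + b * (norm y)\<^sup>2)"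
    using assms by (simp add: field_simps power2_eq_square)
  finally show ?thesis .
qed

lemma quad_P_sing_three:
  assumes "i \<noteq> j" "j \<noteq> m" "i \<noteq> m" and "a > 0" "b > 0"
  shows "quad (P_sing i m) v \<le>
    (1 / a + 1 / b) * (a * quad (P_sing i j) v + b * quad (P_sing j m) v)"
proof -
  let ?N = "\<lambda>p r s. (cmod (v $ s - v $ exch p r s))\<^sup>2"
  define C where "C = 1 / a + 1 / b"
  define h where "h s x y z = v $ (s(i := x, j := y, m := z))" for s x y z
  define T where "T F s = (\<Sum>x\<in>UNIV. \<Sum>y\<in>UNIV. \<Sum>z\<in>UNIV. F (s(i := x, j := y, m := z)))"
    for F :: "('a \<Rightarrow> spin) \<Rightarrow> real" and s
  \<comment> \<open>The inequality can now be checked with all spins outside \<open>i\<close>,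
    \<open>j\<close>, \<open>m\<close> frozen; 8 is one factor 2 per freed qubit.\<close>
  have avg: "(\<Sum>s\<in>UNIV. F s) = (\<Sum>s\<in>UNIV. T F s) / 8" for F
    unfolding T_def
    apply (subst sum_fun_upd[of F m])
    apply (subst sum_fun_upd[of _ j])
    apply (subst sum_fun_upd[of _ i])
    apply simp
    done
  have N: "?N i m (s(i := x, j := y, m := z)) = (cmod (h s x y z - h s z y x))\<^sup>2"
    "?N i j (s(i := x, j := y, m := z)) = (cmod (h s x y z - h s y x z))\<^sup>2"
    "?N j m (s(i := x, j := y, m := z)) = (cmod (h s x y z - h s x z y))\<^sup>2" for s x y z
    using assms by (simp_all add: h_def exch_def fun_upd_twist)
  have "T (?N i m) s \<le> C * (a * T (?N i j) s + b * T (?N j m) s)" for s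
  proof -
    note le = norm_add_power2_le[OF assms(4,5), folded C_def]
    \<comment> \<open>Only unequal end spins contribute. The middle spin \<open>y\<close> matches
      one of them, so the other is in the minority; the difference telescopes through the
      configuration with the minority spin at \<open>j\<close>. The two values of \<open>y\<close>
      together use each term on the right once, up to sign inside the norm.\<close>
    have "(cmod (h s Up y Down - h s Down y Up))\<^sup>2 \<le>
        C * (a * (cmod (h s Up Down y - h s Down Up y))\<^sup>2 +
              b * (cmod (h s y Up Down - h s y Down Up))\<^sup>2)" for y
      using le[of "h s Up Down y - h s Down Up y" "h s y Up Down - h s y Down Up"]
      by (cases y) (simp_all add: algebra_simps)
    from this[of Up] this[of Down] show ?thesis
      unfolding T_def N sum_spin by (simp add: algebra_simps norm_minus_commute)
  qed
  then have "(\<Sum>s\<in>UNIV. T (?N i m) s) \<le>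
      (\<Sum>s\<in>UNIV. C * (a * T (?N i j) s + b * T (?N j m) s))"
    by (rule sum_mono)
  also have "\<dots> = C * (a * (\<Sum>s\<in>UNIV. T (?N i j) s) + b * (\<Sum>s\<in>UNIV. T (?N j m) s))"
    by (simp only: sum.distrib flip: sum_distrib_left)
  finally show ?thesis
    using assms unfolding C_def [symmetric] by (simp add: quad_P_sing avg[of "?N _ _"] field_simps)
qed

text \<open>The factor \<open>\<Sum>l=1..k. 1 / c l\<close> stands in for the normalization, which
  initial segments of the chain do not inherit, so that induction on \<open>k\<close> goes
  through.\<close>

lemma quad_P_sing_chain:
  fixes q :: "nat \<Rightarrow> 'q::finite"
  assumes "k \<ge> 1" "inj_on q {1..k+1}" "\<And>l. l \<in> {1..k} \<Longrightarrow> c l > 0"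
  shows "quad (P_sing (q 1) (q (k+1))) v \<le>
    (\<Sum>l=1..k. 1 / c l) * (\<Sum>l=1..k. c l * quad (P_sing (q l) (q (l+1))) v)"
  using assms
proof (induction k rule: nat_induct_at_least)
  case base
  then show ?case
    by force
next
  case (Suc k)
  let ?S = "\<Sum>l=1..k. 1 / c l"
  let ?E = "\<lambda>i m. quad (P_sing (q i) (q m)) v"
  have c: "c (k+1) > 0" and S: "?S > 0"
    using Suc.prems(2) \<open>1 \<le> k\<close> by (auto intro!: sum_pos)
  have ne: "q 1 \<noteq> q (k+1)" "q (k+1) \<noteq> q (k+2)" "q 1 \<noteq> q (k+2)"
    using Suc.prems(1) \<open>1 \<le> k\<close> by (auto dest!: inj_onD)
  have IH: "?E 1 (k+1) \<le> ?S * (\<Sum>l=1..k. c l * ?E l (l+1))"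
    using Suc.prems by (intro Suc.IH) (auto elim!: inj_on_subset)
  \<comment> \<open>The weight \<open>1 / ?S\<close> on the first link makes the prefactor the
    reciprocal sum up to \<open>k+1\<close> and cancels the factor \<open>?S\<close> of the
    induction hypothesis.\<close>
  have "?E 1 (k+2) \<le> (?S + 1 / c (k+1)) * (1 / ?S * ?E 1 (k+1) + c (k+1) * ?E (k+1) (k+2))"
    using quad_P_sing_three[OF ne, of "1 / ?S" "c (k+1)"] S c by simp
  also have "\<dots> \<le> (?S + 1 / c (k+1)) *
      ((\<Sum>l=1..k. c l * ?E l (l+1)) + c (k+1) * ?E (k+1) (k+2))"
    using IH S c by (intro mult_left_mono add_mono) (auto simp: field_simps)
  finally show ?case
    by simp
qed

theorem lemma1:
  fixes k :: nat and c :: "nat \<Rightarrow> real" and q :: "nat \<Rightarrow> 'q::finite"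
  assumes "k \<ge> 2"
    and "bij_betw q {1..k+1} UNIV"
    and "\<And>l. l \<in> {1..k} \<Longrightarrow> c l > 1"
    and "(\<Sum>l=1..k. inverse (c l)) = 1"
  shows "P_sing (q 1) (q (k+1)) \<le>\<^sub>L (\<Sum>l=1..k. c l *\<^sub>R P_sing (q l) (q (l+1)))"
proof -
  let ?B = "\<Sum>l=1..k. c l *\<^sub>R P_sing (q l) (q (l+1))"
  have inj: "inj_on q {1..k+1}"
    using assms(2) by (rule bij_betw_imp_inj_on)
  then have ne: "q l \<noteq> q m" if "l \<in> {1..k+1}" "m \<in> {1..k+1}" "l \<noteq> m" for l m
    using that by (auto dest: inj_onD)
  have A: "hermitian (P_sing (q 1) (q (k+1)))"
    using assms(1) by (intro hermitian_P_sing ne) auto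
  have B: "hermitian ?B"
    by (intro hermitian_sum hermitian_scaleR hermitian_P_sing ne) auto
  have "quad (P_sing (q 1) (q (k+1))) v \<le> quad ?B v" for v
  proof -
    have "c l > 0" if "l \<in> {1..k}" for l
      using assms(3)[OF that] by simp
    from quad_P_sing_chain[OF _ inj, where c = c and v = v, OF _ this] assms(1,4) show ?thesis
      by (simp add: quad_sum quad_scaleR inverse_eq_divide)
  qed
  then have "pos_semidef (?B - P_sing (q 1) (q (k+1)))"
    using hermitian_diff[OF B A] quad_diff[of ?B "P_sing (q 1) (q (k+1))"]
    unfolding pos_semidef_def quad_def by simp
  with A B show ?thesis
    by (simp add: loewner_le_def)
qed

end
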